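(* There exists a compact set $K\subseteq\mathbb{R}^2$ of two-dimensional Lebesgue measure $0$ and a constant $c>0$ with the following property: for every $a\in[1,2]$ there exist $(x_1,x_2)\in\mathbb{R}^2$ and an interval $I_a\subseteq[0,1]$ of length at least $c$ such that $\{(x_1+t,\,x_2+at^2): t\in I_a\}\subseteq K$ (that is, $K$ contains a piece of length $\sim 1$ of a parabola of every aperture $a\in[1,2]$). Moreover, there is a constant $C$ such that the vertical $\delta$-thickening of $K$ satisfies $|K(\delta)|\le C(\log \delta^{-1})^{-2}$ for all sufficiently small $\delta>0$. Consequently, for all $p,q\in[1,\infty]$ there is a constant $c_{p,q}>0$ independent of $\delta$ such that $$B(p,q,\delta)\ge c_{p,q}(\log\delta^{-1})^{2/p}$$ for all sufficiently small $\delta>0$.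
   Context: For $S\subseteq\mathbb{R}^2$ and $\delta>0$, the vertical $\delta$-thickening is $S(\delta):=\{x+(0,\varepsilon): x\in S,\ -\delta\le\varepsilon\le\delta\}$. For a function $g:\mathbb{R}^2\to\mathbb{C}$, $\delta>0$ and $a\in[1,2]$, define the thickened parabolic maximal function $$\mathcal P_\delta g(a)=\sup_{(x_1,x_2)\in\mathbb{R}^2}(2\delta)^{-1}\int_0^1\int_{-\delta}^{\delta}|g(x_1+t,\,x_2+at^2+s)|\,ds\,dt,$$ and for $p,q\in[1,\infty]$ let $B(p,q,\delta)=\sup_{g\neq 0}\|\mathcal P_\delta g\|_{L^q([1,2])}/\|g\|_{L^p(\mathbb{R}^2)}$. $|\cdot|$ denotes Lebesgue measure. *)

theory Defs
  imports "HOL-Analysis.Analysis"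
begin

definition vthick :: "(real \<times> real) set \<Rightarrow> real \<Rightarrow> (real \<times> real) set" where
  "vthick S \<delta> = {(fst x, snd x + \<epsilon>) | x \<epsilon>. x \<in> S \<and> - \<delta> \<le> \<epsilon> \<and> \<epsilon> \<le> \<delta>}"

text \<open>Power of an extended nonnegative real by a positive real exponent (infinity stays infinity).\<close>
definition epow :: "ennreal \<Rightarrow> real \<Rightarrow> ennreal" where
  "epow x r = (if x = \<infinity> then \<infinity> else ennreal (enn2real x powr r))"

definition Lp_norm :: "'a measure \<Rightarrow> ennreal \<Rightarrow> ('a \<Rightarrow> ennreal) \<Rightarrow> ennreal" where
  "Lp_norm M p f =
     (if p = \<infinity> then Inf {C. AE x in M. f x \<le> C}
      else epow (\<integral>\<^sup>+ x. epow (f x) (enn2real p) \<partial>M) (1 / enn2real p))"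

definition Pmax :: "real \<Rightarrow> (real \<times> real \<Rightarrow> complex) \<Rightarrow> real \<Rightarrow> ennreal" where
  "Pmax \<delta> g a = (SUP x \<in> UNIV.
      ennreal (1 / (2 * \<delta>)) *
      (\<integral>\<^sup>+ t \<in> {0..1}. (\<integral>\<^sup>+ s \<in> {-\<delta>..\<delta>}.
          ennreal (cmod (g (fst x + t, snd x + a * t\<^sup>2 + s))) \<partial>lborel) \<partial>lborel))"

definition Bconst :: "ennreal \<Rightarrow> ennreal \<Rightarrow> real \<Rightarrow> ennreal" where
  "Bconst p q \<delta> = (SUP g \<in> {g :: real \<times> real \<Rightarrow> complex. g \<in> borel_measurable lborel \<and>
        0 < Lp_norm lborel p (\<lambda>x. ennreal (cmod (g x))) \<and>
        Lp_norm lborel p (\<lambda>x. ennreal (cmod (g x))) < \<infinity>}.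
      Lp_norm (restrict_space lborel {1..2}) q (Pmax \<delta> g)
        / Lp_norm lborel p (\<lambda>x. ennreal (cmod (g x))))"

end

theory Submission
  imports Defs
begin

text \<open>
  Write \<open>a = 1 + (\<Sum>j. d\<^sub>j / 2\<^sup>j)\<close> in binary and assign to \<open>a\<close> the parabola
  \<open>y = (x + 1)\<^sup>2 + (\<Sum>j. d\<^sub>j (x - \<xi>\<^sub>j)\<^sup>2 / 2\<^sup>j)\<close> with \<open>\<xi>\<^sub>j = sin (ln j)\<close>, which has leading coefficient \<open>a\<close>.
  The base point \<open>-1\<close> forces the vertex into \<open>[-1, 0]\<close>, so a full unit piece to the right of
  the vertex lies over \<open>[-1, 1]\<close>.
  The slowly oscillating sequence \<open>\<xi>\<close> comes within \<open>1 / n\<close> of any \<open>x \<in> [-1, 1]\<close> at some index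
  \<open>k\<close> comparable to \<open>n\<close>, and then \<open>\<bar>x - \<xi>\<^sub>j\<bar> \<le> (j - k + 1) / n\<close> for \<open>j \<ge> k\<close>. Hence the first
  \<open>k\<close> digits determine the height at \<open>x\<close> up to \<open>O (2\<^sup>-\<^sup>k / n\<^sup>2)\<close>, and the vertical slice of the union
  at \<open>x\<close> has measure \<open>O (1 / n\<^sup>2)\<close>, even after thickening by some \<open>\<delta>\<close> with
  \<open>ln (1 / \<delta>)\<close> comparable to \<open>n\<close>. Testing the maximal function on the indicator of the thickened
  set gives the lower bound for the operator norm.
\<close>

section \<open>Truncated digit parabolas and the compact limit set\<close>

definition node :: "nat \<Rightarrow> real" where
  "node j = sin (ln (real (Suc j)))"

text \<open>\<open>D\<close> collects the positions of the digits 1. Indices start at 0, so weights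
  and nodes are shifted by one against the 1-based series, which keeps the argument of the logarithm
  in \<open>node\<close> positive.\<close>

definition parab :: "nat set \<Rightarrow> real \<Rightarrow> real" where
  "parab D x = (x + 1)\<^sup>2 + (\<Sum>j\<in>D. (x - node j)\<^sup>2 / 2 ^ Suc j)"

text \<open>The margin \<open>4 / 2 ^ N\<close> leaves room for all the digits beyond the first \<open>N\<close>; intersecting over
  \<open>N\<close> then yields a compact set without any topology on the space of digit sequences.\<close>

definition stage :: "nat \<Rightarrow> real \<Rightarrow> (real \<times> real) set" where
  "stage N \<delta> = (\<Union>D\<in>Pow {..<N}. (\<lambda>(x, e). (x, parab D x + e)) ` ({-1..1} \<times> {-\<delta>..4 / 2 ^ N + \<delta>}))"

definition parabola_set :: "(real \<times> real) set" where
  "parabola_set = (\<Inter>N. stage N 0)"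

lemma abs_node_le_1: "\<bar>node j\<bar> \<le> 1"
  by (simp add: node_def)

lemma compact_stage: "compact (stage N \<delta>)"
  unfolding stage_def parab_def case_prod_beta
  by (intro compact_UN compact_continuous_image compact_Times continuous_intros) auto

lemma compact_parabola_set: "compact parabola_set"
  unfolding parabola_set_def by (rule compact_Inter) (auto simp: compact_stage)

lemma mem_stage_iff:
  "(x, y) \<in> stage N \<delta> \<longleftrightarrow> \<bar>x\<bar> \<le> 1 \<and>
     (\<exists>D\<subseteq>{..<N}. parab D x - \<delta> \<le> y \<and> y \<le> parab D x + 4 / 2 ^ N + \<delta>)"
proof -
  have stage: "(x, y) \<in> stage N \<delta> \<longleftrightarrow>
      (\<exists>D\<subseteq>{..<N}. \<exists>e\<in>{-\<delta>..4 / 2 ^ N + \<delta>}. \<bar>x\<bar> \<le> 1 \<and> y = parab D x + e)"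
    unfolding stage_def by (auto simp: image_iff abs_le_iff)
  have e: "(\<exists>e\<in>{-\<delta>..4 / 2 ^ N + \<delta>}. \<bar>x\<bar> \<le> 1 \<and> y = parab D x + e) \<longleftrightarrow>
      \<bar>x\<bar> \<le> 1 \<and> parab D x - \<delta> \<le> y \<and> y \<le> parab D x + 4 / 2 ^ N + \<delta>" for D
    by (auto intro!: bexI[of _ "y - parab D x"])
  show ?thesis unfolding stage e by blast
qed

text \<open>Every upper bound on the measure of \<open>parabola_set\<close> and its thickenings
  passes through this inclusion: the stage is compact, hence measurable, and \<open>N\<close> may be
  chosen in terms of \<open>\<delta>\<close>.\<close>

lemma vthick_parabola_set_subset_stage: "vthick parabola_set \<delta> \<subseteq> stage N \<delta>"
proof
  fix z assume "z \<in> vthick parabola_set \<delta>"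
  then obtain x y e where z: "z = (x, y + e)" "(x, y) \<in> parabola_set" "-\<delta> \<le> e" "e \<le> \<delta>"
    unfolding vthick_def by auto
  then have "(x, y) \<in> stage N 0" by (auto simp: parabola_set_def)
  then obtain D where "\<bar>x\<bar> \<le> 1" "D \<subseteq> {..<N}" "parab D x \<le> y" "y \<le> parab D x + 4 / 2 ^ N"
    by (auto simp: mem_stage_iff)
  then show "z \<in> stage N \<delta>"
    using z(3,4) unfolding z(1) mem_stage_iff by (intro conjI exI[of _ D]) auto
qed

lemma subset_vthick: "0 \<le> \<delta> \<Longrightarrow> S \<subseteq> vthick S \<delta>"
  unfolding vthick_def by force

section \<open>Binary digits and the parabolas inside the limit set\<close>

lemma binary_expansion_exists:
  fixes s :: real
  assumes "0 \<le> s" "s \<le> 1"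
  shows "\<exists>S. (\<lambda>j. of_bool (j \<in> S) / 2 ^ Suc j) sums s"
proof -
  \<comment> \<open>\<open>r n\<close> is the remainder after \<open>n\<close> digits, scaled by
    \<open>2 ^ n\<close>. Its invariant interval is closed: \<open>s = 1\<close> is covered by the
    fixed point 1, which produces only digits 1.\<close>
  define r where "r = rec_nat s (\<lambda>_ r. if r \<ge> 1/2 then 2 * r - 1 else 2 * r)"
  have r0: "r 0 = s" and rS: "r (Suc n) = (if r n \<ge> 1/2 then 2 * r n - 1 else 2 * r n)" for n
    by (simp_all add: r_def)
  have r01: "0 \<le> r n \<and> r n \<le> 1" for n
    by (induction n) (use assms in \<open>auto simp: r0 rS\<close>)
  define S where "S = {j. r j \<ge> 1/2}"
  have eq: "(\<Sum>j<n. of_bool (j \<in> S) / 2 ^ Suc j) = s - r n / 2 ^ n" for n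
    by (induction n) (auto simp: r0 rS S_def field_simps)
  have "(\<lambda>n. r n / 2 ^ n) \<longlonglongrightarrow> 0"
  proof (rule tendsto_sandwich)
    show "\<forall>\<^sub>F n in sequentially. 0 \<le> r n / 2 ^ n" using r01 by simp
    show "\<forall>\<^sub>F n in sequentially. r n / 2 ^ n \<le> (1/2) ^ n"
      using r01 by (simp add: power_divide divide_right_mono)
    show "(\<lambda>n. (1/2::real) ^ n) \<longlonglongrightarrow> 0" by (rule LIMSEQ_realpow_zero) auto
  qed simp
  then have "(\<lambda>n. s - r n / 2 ^ n) \<longlonglongrightarrow> s"
    using tendsto_diff[OF tendsto_const, of _ 0 _ s] by fastforce
  then show ?thesis unfolding sums_def eq[symmetric] by blast
qed

lemma sums_pow2: "(\<lambda>j. c / 2 ^ Suc (j + N)) sums (c / 2 ^ N :: real)"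
proof -
  have "(\<lambda>j. (c / 2 ^ N) * (1/2) ^ Suc j) sums ((c / 2 ^ N) * 1)"
    by (intro sums_mult power_half_series)
  then show ?thesis by (simp add: power_add power_divide mult_ac field_simps)
qed

text \<open>With the digits of \<open>a - 1\<close>, the full series is a quadratic with leading
  coefficient \<open>a\<close>. Dropping the digits from \<open>N\<close> on lowers it by a tail
  between 0 and \<open>4 / 2 ^ N\<close>, exactly the margin allowed in
  \<open>stage\<close>.\<close>

lemma parabola_set_contains:
  assumes a: "a \<in> {1..2::real}"
  shows "\<exists>x1 x2. \<forall>t\<in>{0..1}. (x1 + t, x2 + a * t\<^sup>2) \<in> parabola_set"
proof -
  obtain S where S: "(\<lambda>j. of_bool (j \<in> S) / 2 ^ Suc j :: real) sums (a - 1)"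
    using binary_expansion_exists[of "a - 1"] a by auto
  define w where "w j = (of_bool (j \<in> S) / 2 ^ Suc j :: real)" for j
  have w: "w sums (a - 1)" using S by (simp add: w_def[abs_def])
  have w0: "0 \<le> w j" for j by (simp add: w_def)
  have bnd: "\<bar>node j\<bar> * w j \<le> w j" "(node j)\<^sup>2 * w j \<le> w j" for j
    using mult_right_mono[OF _ w0[of j], of "\<bar>node j\<bar>" 1] mult_right_mono[OF _ w0[of j], of "(node j)\<^sup>2" 1]
      abs_node_le_1[of j] by (auto simp: abs_square_le_1)
  have sumB: "summable (\<lambda>j. node j * w j)"
    by (rule summable_comparison_test'[OF sums_summable[OF w], of 0]) (use bnd w0 in \<open>auto simp: abs_mult\<close>)
  have sumC: "summable (\<lambda>j. (node j)\<^sup>2 * w j)"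
    by (rule summable_comparison_test'[OF sums_summable[OF w], of 0]) (use bnd w0 in \<open>auto simp: abs_mult\<close>)
  define B where "B = (\<Sum>j. node j * w j)"
  define C where "C = (\<Sum>j. (node j)\<^sup>2 * w j)"
  have B: "(\<lambda>j. node j * w j) sums B" and C: "(\<lambda>j. (node j)\<^sup>2 * w j) sums C"
    using sumB sumC by (auto simp: B_def C_def)
  have nw: "- w j \<le> node j * w j" "node j * w j \<le> w j" for j
    using bnd(1)[of j] w0[of j] abs_node_le_1[of j]
      mult_right_mono[of "node j" 1 "w j"] mult_right_mono[of "-1" "node j" "w j"] by (auto simp: abs_le_iff)
  have Bu: "B \<le> a - 1" by (rule sums_le[OF _ B w]) (rule nw)
  have Bl: "-(a - 1) \<le> B" by (rule sums_le[OF _ sums_minus[OF w] B]) (rule nw)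
  \<comment> \<open>Abscissa of the vertex of
    \<open>a * x\<^sup>2 - 2 * (B - 1) * x + 1 + C\<close>, the expanded full series. The bounds
    \<open>\<bar>B\<bar> \<le> a - 1\<close> put it in \<open>{-1..0}\<close>, so
    \<open>x1 + t\<close> stays in \<open>{-1..1}\<close>.\<close>
  define x1 where "x1 = (B - 1) / a"
  define x2 where "x2 = 1 + C - a * x1\<^sup>2"
  have ax1: "a * x1 = B - 1" using a by (simp add: x1_def)
  have x1: "-1 \<le> x1" "x1 \<le> 0"
    using Bu Bl a by (auto simp: x1_def field_simps)
  have "(x1 + t, x2 + a * t\<^sup>2) \<in> stage N 0" if t: "t \<in> {0..1}" for t N
  proof -
    define x where "x = x1 + t"
    have x: "\<bar>x\<bar> \<le> 1" using x1 t by (auto simp: x_def)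
    define f where "f j = (x - node j)\<^sup>2 * w j" for j
    have "(\<lambda>j. x\<^sup>2 * w j - 2 * x * (node j * w j) + (node j)\<^sup>2 * w j) sums (x\<^sup>2 * (a - 1) - 2 * x * B + C)"
      by (intro sums_add sums_diff sums_mult w B C)
    also have "(\<lambda>j. x\<^sup>2 * w j - 2 * x * (node j * w j) + (node j)\<^sup>2 * w j) = f"
      by (auto simp: f_def fun_eq_iff power2_diff algebra_simps)
    finally have f: "f sums (x\<^sup>2 * (a - 1) - 2 * x * B + C)" .
    have eqf: "(x + 1)\<^sup>2 + suminf f = x2 + a * t\<^sup>2"
    proof -
      have "x2 + a * t\<^sup>2 = 1 + C + a * x\<^sup>2 - 2 * x * (a * x1)"
        by (simp add: x2_def x_def power2_eq_square algebra_simps)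
      also have "\<dots> = (x + 1)\<^sup>2 + (x\<^sup>2 * (a - 1) - 2 * x * B + C)"
        unfolding ax1 by (simp add: power2_eq_square algebra_simps)
      finally show ?thesis using sums_unique[OF f] by simp
    qed
    have f0: "0 \<le> f j" for j by (simp add: f_def w0)
    have f4: "f j \<le> 4 / 2 ^ Suc j" for j
    proof -
      have "(x - node j)\<^sup>2 \<le> 2\<^sup>2"
        using x abs_node_le_1[of j] by (intro abs_le_square_iff[THEN iffD1]) auto
      then have "(x - node j)\<^sup>2 * w j \<le> 4 * (1 / 2 ^ Suc j)"
        by (intro mult_mono) (auto simp: w_def)
      then show ?thesis by (simp add: f_def)
    qed
    have pD: "parab (S \<inter> {..<N}) x = (x + 1)\<^sup>2 + sum f {..<N}"
    proof -
      have "(\<Sum>j\<in>S \<inter> {..<N}. (x - node j)\<^sup>2 / 2 ^ Suc j) = sum f {..<N}"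
        by (rule sum.mono_neutral_cong_left) (auto simp: f_def w_def)
      then show ?thesis by (simp add: parab_def)
    qed
    have split: "suminf f = (\<Sum>j. f (j + N)) + sum f {..<N}"
      by (rule suminf_split_initial_segment[OF sums_summable[OF f]])
    have sumN: "summable (\<lambda>j. f (j + N))"
      using sums_summable[OF f] by (simp add: summable_iff_shift)
    have t1: "0 \<le> (\<Sum>j. f (j + N))" by (rule suminf_nonneg[OF sumN f0])
    have t2: "(\<Sum>j. f (j + N)) \<le> 4 / 2 ^ N"
      by (rule sums_le[OF _ summable_sums[OF sumN] sums_pow2]) (rule f4)
    show ?thesis
      unfolding x_def[symmetric] eqf[symmetric] mem_stage_iff
      using x split pD t1 t2 by (intro conjI exI[of _ "S \<inter> {..<N}"]) auto
  qed
  then show ?thesis unfolding parabola_set_def by blast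
qed

section \<open>Slow oscillation of the nodes\<close>

lemma abs_sin_diff_le: "\<bar>sin x - sin y\<bar> \<le> \<bar>x - y\<bar>" for x y :: real
proof -
  have "\<bar>sin x - sin y\<bar> = 2 * \<bar>sin ((x - y) / 2)\<bar> * \<bar>cos ((x + y) / 2)\<bar>"
    by (simp add: sin_diff_sin abs_mult)
  also have "\<dots> \<le> (2 * \<bar>(x - y) / 2\<bar>) * 1"
    by (intro mult_mono abs_sin_x_le_abs_x) auto
  finally show ?thesis by simp
qed

definition spread :: nat where
  "spread = nat \<lceil>exp (2 * pi)\<rceil>"

lemma spread_pos: "0 < spread"
  by (simp add: spread_def)

text \<open>The factor \<open>spread\<close> is one full period of \<open>sin \<circ> ln\<close> in multiplicative form: solve
  \<open>x = sin (ln s)\<close> with \<open>n \<le> s \<le> n * exp (2 * pi)\<close> and round \<open>s\<close> down to \<open>k\<close>.\<close>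

lemma node_near:
  assumes x: "\<bar>x\<bar> \<le> 1" and n: "0 < n"
  obtains k where "k \<le> spread * n" "\<And>j. k \<le> j \<Longrightarrow> \<bar>x - node j\<bar> \<le> real (Suc (j - k)) / real n"
proof -
  \<comment> \<open>Selects the representative \<open>\<theta>\<close> of \<open>arcsin x\<close>
    modulo \<open>2 * pi\<close> in the window from \<open>ln n\<close> to
    \<open>ln n + 2 * pi\<close>.\<close>
  define m where "m = \<lceil>(ln (real n) - arcsin x) / (2 * pi)\<rceil>"
  define \<theta> where "\<theta> = arcsin x + 2 * pi * of_int m"
  define s where "s = exp \<theta>"
  have m: "(ln (real n) - arcsin x) / (2 * pi) \<le> of_int m" "of_int m \<le> (ln (real n) - arcsin x) / (2 * pi) + 1"
    unfolding m_def by linarith+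
  have \<theta>: "ln (real n) \<le> \<theta>" "\<theta> \<le> ln (real n) + 2 * pi"
    using m by (auto simp: \<theta>_def field_simps)
  have "sin \<theta> = x"
    using x sin.plus_of_int[of "arcsin x" m] by (simp add: \<theta>_def abs_le_iff mult_ac)
  have sn: "real n \<le> s"
    using \<theta>(1) n by (simp add: s_def ln_ge_iff ln_le_cancel_iff[symmetric, of "real n" "exp \<theta>"] del: ln_le_cancel_iff)
  have "s \<le> exp (ln (real n) + 2 * pi)" using \<theta>(2) by (simp add: s_def)
  also have "\<dots> = real n * exp (2 * pi)" using n by (simp add: exp_add)
  also have "\<dots> \<le> real n * real spread"
    unfolding spread_def by (intro mult_left_mono) linarith+
  finally have sQ: "s \<le> real (spread * n)" by (simp add: mult.commute)
  \<comment> \<open>Rounding down, together with the \<open>Suc\<close> in \<open>node\<close>,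
    gives \<open>k \<le> s \<le> Suc j\<close> for every \<open>j \<ge> k\<close>, so the difference
    of logarithms below has a known sign.\<close>
  define k where "k = nat \<lfloor>s\<rfloor>"
  have k: "real k \<le> s" "s \<le> real k + 1" using sn by (auto simp: k_def)
  have "k \<le> spread * n" using k(1) sQ by linarith
  moreover have "\<bar>x - node j\<bar> \<le> real (Suc (j - k)) / real n" if "k \<le> j" for j
  proof -
    have s0: "0 < s" by (simp add: s_def)
    have sj: "s \<le> real (Suc j)" using that k by linarith
    have "\<bar>x - node j\<bar> = \<bar>sin (ln (real (Suc j))) - sin \<theta>\<bar>"
      using \<open>sin \<theta> = x\<close> by (simp add: node_def)
    also have "\<dots> \<le> \<bar>ln (real (Suc j)) - \<theta>\<bar>" by (rule abs_sin_diff_le)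
    also have "\<dots> = ln (real (Suc j) / s)"
      using sj s0 by (simp add: ln_div s_def flip: ln_ge_iff)
    also have "\<dots> \<le> real (Suc j) / s - 1" using s0 by (intro ln_le_minus_one) auto
    also have "\<dots> = (real (Suc j) - s) / s" using s0 by (simp add: field_simps)
    \<comment> \<open>The numerator uses \<open>k \<le> s\<close>, the denominator
      \<open>n \<le> s\<close>.\<close>
    also have "\<dots> \<le> real (Suc (j - k)) / real n"
      using sj sn n k that by (intro frac_le) auto
    finally show ?thesis .
  qed
  ultimately show ?thesis using that by blast
qed

section \<open>Measure of slices and stages\<close>

lemma sum_squares_pow2_le: "(\<Sum>i<m. (real (Suc i))\<^sup>2 / 2 ^ Suc i) \<le> 6"
proof -
  \<comment> \<open>The infinite series has sum 6; carrying the exact remainder makes the bound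
    inductive.\<close>
  have "(\<Sum>i<m. (real (Suc i))\<^sup>2 / 2 ^ Suc i) = 6 - ((real m + 1)\<^sup>2 + 2 * (real m + 1) + 3) / 2 ^ m"
    by (induction m) (simp_all add: field_simps power2_eq_square)
  also have "\<dots> \<le> 6" by simp
  finally show ?thesis .
qed

lemma square_le_pow2: "(real n)\<^sup>2 \<le> 4 * 2 ^ n"
proof -
  \<comment> \<open>The second conjunct controls the increment \<open>2 * n + 1\<close> of the
    square.\<close>
  have "(real n)\<^sup>2 \<le> 4 * 2 ^ n \<and> 2 * real n + 2 \<le> 4 * 2 ^ n"
    by (induction n) (auto simp: power2_eq_square algebra_simps)
  then show ?thesis ..
qed

text \<open>Fixing the first \<open>k\<close> digits leaves \<open>2 ^ k\<close> intervals. The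
  nodes from \<open>k\<close> on start close to \<open>x\<close> and drift slowly, so the later
  digits add at most \<open>6 / (2 ^ k * n\<^sup>2)\<close> to each length; the count cancels and
  \<open>6 / n\<^sup>2\<close> remains. Margin and thickening cost at most another
  \<open>24 / n\<^sup>2\<close>.\<close>

lemma emeasure_stage_slice_le:
  assumes x: "\<bar>x\<bar> \<le> 1" and n: "0 < n" and \<delta>: "0 \<le> \<delta>" "\<delta> \<le> 1 / 4 ^ (spread * n)"
  shows "emeasure lborel (Pair x -` stage (2 * spread * n) \<delta>) \<le> ennreal (30 / (real n)\<^sup>2)"
proof -
  define N where "N = 2 * spread * n"
  obtain k where k: "k \<le> spread * n"
    "\<And>j. k \<le> j \<Longrightarrow> \<bar>x - node j\<bar> \<le> real (Suc (j - k)) / real n"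
    using node_near[OF x n] by blast
  define T where "T = (\<Sum>j=k..<N. (x - node j)\<^sup>2 / 2 ^ Suc j)"
  have kN: "k \<le> N" using k(1) by (simp add: N_def)
  have "T \<le> (\<Sum>j=k..<N. (real (Suc (j - k)))\<^sup>2 / 2 ^ Suc (j - k) / (2 ^ k * (real n)\<^sup>2))"
    unfolding T_def
  proof (rule sum_mono)
    fix j assume j: "j \<in> {k..<N}"
    have "(x - node j)\<^sup>2 \<le> (real (Suc (j - k)) / real n)\<^sup>2"
      using k(2)[of j] j by (intro abs_le_square_iff[THEN iffD1]) auto
    then have "(x - node j)\<^sup>2 / 2 ^ Suc j \<le> (real (Suc (j - k)) / real n)\<^sup>2 / 2 ^ Suc j"
      by (intro divide_right_mono) auto
    also have "\<dots> = (real (Suc (j - k)) / real n)\<^sup>2 / (2 ^ Suc (j - k) * 2 ^ k)"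
      using j by (simp flip: power_add)
    finally show "(x - node j)\<^sup>2 / 2 ^ Suc j \<le> (real (Suc (j - k)))\<^sup>2 / 2 ^ Suc (j - k) / (2 ^ k * (real n)\<^sup>2)"
      by (simp only: power_divide divide_divide_eq_left mult_ac)
  qed
  also have "\<dots> = (\<Sum>j=k..<N. (real (Suc (j - k)))\<^sup>2 / 2 ^ Suc (j - k)) / (2 ^ k * (real n)\<^sup>2)"
    by (rule sum_divide_distrib[symmetric])
  also have "(\<Sum>j=k..<N. (real (Suc (j - k)))\<^sup>2 / 2 ^ Suc (j - k)) = (\<Sum>i<N - k. (real (Suc i))\<^sup>2 / 2 ^ Suc i)"
    using kN by (intro sum.reindex_bij_witness[of _ "\<lambda>i. i + k" "\<lambda>j. j - k"]) auto
  also have "\<dots> / (2 ^ k * (real n)\<^sup>2) \<le> 6 / (2 ^ k * (real n)\<^sup>2)"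
    by (intro divide_right_mono sum_squares_pow2_le) auto
  finally have T: "2 ^ k * T \<le> 6 / (real n)\<^sup>2"
    using n by (simp add: field_simps)
  have T0: "0 \<le> T" unfolding T_def by (intro sum_nonneg) auto
  define R where "R = T + 4 / 2 ^ N + 2 * \<delta>"
  have R0: "0 \<le> R" using T0 \<delta> by (simp add: R_def)
  \<comment> \<open>Intersecting \<open>D\<close> with \<open>{..<k}\<close> selects the interval;
    the remaining digits raise the height by between 0 and \<open>T\<close>.\<close>
  have sub: "Pair x -` stage N \<delta> \<subseteq> (\<Union>D\<in>Pow {..<k}. {parab D x - \<delta>..parab D x - \<delta> + R})"
  proof
    fix y assume "y \<in> Pair x -` stage N \<delta>"
    then obtain D where D: "D \<subseteq> {..<N}" "parab D x - \<delta> \<le> y" "y \<le> parab D x + 4 / 2 ^ N + \<delta>"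
      by (auto simp: mem_stage_iff)
    have finD: "finite D" using D(1) finite_subset by blast
    have "parab D x = parab (D \<inter> {..<k}) x + (\<Sum>j\<in>D - {..<k}. (x - node j)\<^sup>2 / 2 ^ Suc j)"
      unfolding parab_def using sum.Int_Diff[OF finD, of _ "{..<k}"] by (simp add: add.assoc)
    moreover have "(\<Sum>j\<in>D - {..<k}. (x - node j)\<^sup>2 / 2 ^ Suc j) \<le> T"
      unfolding T_def using D(1) by (intro sum_mono2) auto
    moreover have "0 \<le> (\<Sum>j\<in>D - {..<k}. (x - node j)\<^sup>2 / 2 ^ Suc j)" by (intro sum_nonneg) auto
    ultimately show "y \<in> (\<Union>D\<in>Pow {..<k}. {parab D x - \<delta>..parab D x - \<delta> + R})"
      using D(2,3) by (intro UN_I[of "D \<inter> {..<k}"]) (auto simp: R_def)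
  qed
  have "emeasure lborel (Pair x -` stage N \<delta>) \<le>
      emeasure lborel (\<Union>D\<in>Pow {..<k}. {parab D x - \<delta>..parab D x - \<delta> + R})"
    by (rule emeasure_mono[OF sub]) (auto intro!: sets.finite_UN)
  also have "\<dots> \<le> (\<Sum>D\<in>Pow {..<k}. emeasure lborel {parab D x - \<delta>..parab D x - \<delta> + R})"
    by (rule emeasure_subadditive_finite) auto
  also have "\<dots> = ennreal (2 ^ k * R)"
    using R0 by (simp add: card_Pow ennreal_mult ennreal_power flip: ennreal_numeral)
  also have "2 ^ k * R \<le> 30 / (real n)\<^sup>2"
  proof -
    define M where "M = spread * n"
    have nM: "n \<le> M" using spread_pos by (simp add: M_def)
    have N2: "(2::real) ^ N = 2 ^ M * 2 ^ M" by (simp add: N_def M_def algebra_simps flip: power_add)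
    have M4: "(4::real) ^ M = 2 ^ M * 2 ^ M" by (simp flip: power_mult_distrib)
    \<comment> \<open>As \<open>N = 2 * M\<close>, both terms are of order at most
      \<open>1 / 4 ^ M\<close>. Multiplying by \<open>2 ^ k \<le> 2 ^ M\<close> still leaves the
      exponentially small factor \<open>1 / 2 ^ M\<close>.\<close>
    have "4 / 2 ^ N + 2 * \<delta> \<le> 6 / (2 ^ M * 2 ^ M)"
      using \<delta>(2) unfolding M_def[symmetric] N2 M4 by (simp add: field_simps)
    then have "2 ^ k * (4 / 2 ^ N + 2 * \<delta>) \<le> 2 ^ M * (6 / (2 ^ M * 2 ^ M))"
      using k(1) \<delta> by (intro mult_mono power_increasing) (auto simp: M_def)
    also have "\<dots> = 6 / 2 ^ M" by simp
    also have "\<dots> \<le> 6 / 2 ^ n" using nM by (intro divide_left_mono power_increasing) auto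
    also have "\<dots> \<le> 24 / (real n)\<^sup>2"
      using square_le_pow2[of n] n by (simp add: field_simps)
    finally show ?thesis using T by (simp add: R_def algebra_simps)
  qed
  finally show ?thesis unfolding N_def by (simp add: ennreal_leI)
qed

text \<open>Fubini over the base \<open>{-1..1}\<close>, whose length 2 doubles the slice
  constant.\<close>

lemma emeasure_stage_le:
  assumes n: "0 < n" and \<delta>: "0 \<le> \<delta>" "\<delta> \<le> 1 / 4 ^ (spread * n)"
  shows "emeasure lborel (stage (2 * spread * n) \<delta>) \<le> ennreal (60 / (real n)\<^sup>2)"
proof -
  let ?E = "stage (2 * spread * n) \<delta>"
  have "?E \<in> sets (lborel \<Otimes>\<^sub>M lborel)"
    unfolding lborel_prod using compact_stage[of "2 * spread * n" \<delta>] by (simp add: borel_compact)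
  then have "emeasure (lborel \<Otimes>\<^sub>M lborel) ?E = (\<integral>\<^sup>+ x. emeasure lborel (Pair x -` ?E) \<partial>lborel)"
    by (rule lborel.emeasure_pair_measure_alt)
  also have "\<dots> \<le> (\<integral>\<^sup>+ x. ennreal (30 / (real n)\<^sup>2) * indicator {-1..1::real} x \<partial>lborel)"
  proof (rule nn_integral_mono)
    fix x :: real
    show "emeasure lborel (Pair x -` ?E) \<le> ennreal (30 / (real n)\<^sup>2) * indicator {-1..1} x"
    proof (cases "\<bar>x\<bar> \<le> 1")
      case True
      then show ?thesis using emeasure_stage_slice_le[OF True n \<delta>] by (auto simp: indicator_def abs_le_iff)
    next
      case False
      then have "Pair x -` ?E = {}" by (auto simp: mem_stage_iff)
      then show ?thesis by simp
    qed
  qed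
  also have "\<dots> = ennreal (30 / (real n)\<^sup>2) * 2"
    by (simp add: nn_integral_cmult_indicator)
  also have "\<dots> = ennreal (60 / (real n)\<^sup>2)"
    by (simp add: ennreal_mult[symmetric] flip: ennreal_numeral)
  finally show ?thesis unfolding lborel_prod .
qed

lemma emeasure_parabola_set: "emeasure lborel parabola_set = 0"
proof -
  have le: "emeasure lborel parabola_set \<le> ennreal (60 / (real (Suc n))\<^sup>2)" for n
  proof -
    let ?d = "1 / 4 ^ (spread * Suc n) :: real"
    have "parabola_set \<subseteq> stage (2 * spread * Suc n) ?d"
      using subset_vthick[of ?d parabola_set] vthick_parabola_set_subset_stage by fastforce
    then have "emeasure lborel parabola_set \<le> emeasure lborel (stage (2 * spread * Suc n) ?d)"
      by (intro emeasure_mono) (auto simp: borel_compact compact_stage)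
    also have "\<dots> \<le> ennreal (60 / (real (Suc n))\<^sup>2)" by (rule emeasure_stage_le) auto
    finally show ?thesis .
  qed
  have "(\<lambda>n. 60 * (inverse (real (Suc n)))\<^sup>2) \<longlonglongrightarrow> 60 * 0\<^sup>2"
    by (intro tendsto_intros LIMSEQ_inverse_real_of_nat)
  then have "(\<lambda>n. 60 / (real (Suc n))\<^sup>2) \<longlonglongrightarrow> 0" by (simp add: field_simps)
  then have "(\<lambda>n. ennreal (60 / (real (Suc n))\<^sup>2)) \<longlonglongrightarrow> ennreal 0" by (rule tendsto_ennrealI)
  then have "emeasure lborel parabola_set \<le> ennreal 0"
    by (rule LIMSEQ_le_const) (use le in blast)
  then show ?thesis by simp
qed

text \<open>The bound is put on stages because they serve both as covers of the thickened set and as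
  test sets for the maximal function. The index comes from taking \<open>n\<close> comparable to
  \<open>ln (1 / \<delta>)\<close>.\<close>

lemma stage_measure_log:
  obtains C \<delta>\<^sub>0 :: real and N :: "real \<Rightarrow> nat" where "0 < C" "0 < \<delta>\<^sub>0" "\<delta>\<^sub>0 \<le> 1"
    "\<And>\<delta>. 0 < \<delta> \<Longrightarrow> \<delta> < \<delta>\<^sub>0 \<Longrightarrow>
       emeasure lborel (stage (N \<delta>) \<delta>) \<le> ennreal (C * ln (1 / \<delta>) powr (-2))"
proof -
  \<comment> \<open>With this scale, \<open>n \<le> ln (1 / \<delta>) / q\<close> yields
    \<open>\<delta> \<le> exp (- q * n)\<close>, and \<open>exp 1 \<ge> 2\<close> turns this into
    \<open>\<delta> \<le> 1 / 4 ^ (spread * n)\<close>. The threshold \<open>exp (- q)\<close>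
    forces \<open>n \<ge> 1\<close>.\<close>
  define q where "q = 2 * real spread"
  have q: "0 < q" using spread_pos by (simp add: q_def)
  define n where "n \<delta> = nat \<lfloor>ln (1 / \<delta>) / q\<rfloor>" for \<delta>
  have "emeasure lborel (stage (2 * spread * n \<delta>) \<delta>) \<le> ennreal (60 * (2 * q)\<^sup>2 * ln (1 / \<delta>) powr (-2))"
    if \<delta>: "0 < \<delta>" "\<delta> < exp (- q)" for \<delta>
  proof -
    define L where "L = ln (1 / \<delta>)"
    have "ln \<delta> < - q" using \<delta> by (metis ln_less_cancel_iff exp_gt_zero ln_exp)
    then have L: "q < L" using \<delta> by (simp add: L_def ln_div)
    have z: "1 \<le> L / q" using L q by simp
    have n1: "1 \<le> n \<delta>" using z unfolding n_def L_def[symmetric] by linarith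
    have nu: "real (n \<delta>) \<le> L / q" and nl: "L / q \<le> real (n \<delta>) + 1"
      using z unfolding n_def L_def[symmetric] by linarith+
    have "L / (2 * q) = L / q / 2" by simp
    \<comment> \<open>Since \<open>n \<ge> 1\<close>, rounding costs only a factor 2:
      \<open>L / q \<le> n + 1 \<le> 2 * n\<close>.\<close>
    then have nl2: "L / (2 * q) \<le> real (n \<delta>)" using nl n1 by linarith
    have "\<delta> = exp (- L)" using \<delta> by (simp add: L_def ln_div)
    also have "\<dots> \<le> exp (- (real (2 * (spread * n \<delta>))))"
      using nu q by (simp add: q_def field_simps)
    also have "\<dots> = 1 / exp 1 ^ (2 * (spread * n \<delta>))"
      by (simp only: exp_minus exp_of_nat_mult[symmetric]) (simp add: field_simps)
    also have "\<dots> \<le> 1 / 2 ^ (2 * (spread * n \<delta>))"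
      using exp_ge_add_one_self[of 1] by (intro divide_left_mono power_mono) auto
    also have "\<dots> = 1 / 4 ^ (spread * n \<delta>)" by (simp add: power_mult)
    finally have "emeasure lborel (stage (2 * spread * n \<delta>) \<delta>) \<le> ennreal (60 / (real (n \<delta>))\<^sup>2)"
      using n1 \<delta> by (intro emeasure_stage_le) auto
    also have "\<dots> \<le> ennreal (60 / (L / (2 * q))\<^sup>2)"
      using nl2 L q n1 by (intro ennreal_leI divide_left_mono power_mono mult_pos_pos) auto
    also have "60 / (L / (2 * q))\<^sup>2 = 60 * (2 * q)\<^sup>2 * L powr (-2)"
      using L q by (simp add: power_divide powr_minus_divide)
    finally show ?thesis by (simp add: L_def)
  qed
  then show ?thesis
    using q by (intro that[of "60 * (2 * q)\<^sup>2" "exp (- q)" "\<lambda>\<delta>. 2 * spread * n \<delta>"]) auto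
qed

section \<open>Testing the maximal function on indicators of stages\<close>

lemma emeasure_stage_pos:
  assumes "0 < \<delta>"
  shows "0 < emeasure lborel (stage N \<delta>)"
proof -
  define r where "r = min 1 \<delta>"
  have r: "0 < r" "r \<le> 1" "r \<le> \<delta>" using assms by (auto simp: r_def)
  \<comment> \<open>Near its vertex the digit-free parabola \<open>(x + 1)\<^sup>2\<close> stays
    below \<open>\<delta>\<close>, so a small square at \<open>(-1, 0)\<close> lies in its
    thickening.\<close>
  have "cbox (-1, 0) (-1 + r, r) \<subseteq> stage N \<delta>"
  proof
    fix z assume "z \<in> cbox (-1, 0) (-1 + r, r)"
    then obtain x y where z: "z = (x, y)" "-1 \<le> x" "x \<le> -1 + r" "0 \<le> y" "y \<le> r"
      by (cases z) (auto simp: cbox_Pair_eq)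
    have "(x + 1)\<^sup>2 \<le> r * 1"
      unfolding power2_eq_square using z r by (intro mult_mono) auto
    then have "(x + 1)\<^sup>2 \<le> \<delta>" using r by linarith
    moreover have "0 \<le> (x + 1)\<^sup>2" "0 \<le> 4 / (2::real) ^ N" by simp_all
    ultimately have "parab {} x - \<delta> \<le> y" "y \<le> parab {} x + 4 / 2 ^ N + \<delta>"
      using z r unfolding parab_def sum.empty by linarith+
    then show "z \<in> stage N \<delta>"
      unfolding z(1) mem_stage_iff using z r by (intro conjI exI[of _ "{}"]) auto
  qed
  then have "emeasure lborel (cbox (-1, 0) (-1 + r, r)) \<le> emeasure lborel (stage N \<delta>)"
    by (intro emeasure_mono) (auto simp: borel_compact compact_stage)
  moreover have "0 < emeasure lborel (cbox (-1, 0::real) (-1 + r, r))"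
    using r by (subst emeasure_lborel_cbox) (auto simp: Basis_prod_def prod.union_disjoint)
  ultimately show ?thesis by simp
qed

text \<open>The stage contains the thickening of a unit piece of the parabola of aperture
  \<open>a\<close>; at the corresponding translate the integrand is 1 throughout, so the average
  equals 1.\<close>

lemma Pmax_indicator_ge_1:
  assumes \<delta>: "0 < \<delta>" and a: "a \<in> {1..2}"
  shows "1 \<le> Pmax \<delta> (indicator (stage N \<delta>)) a"
proof -
  obtain x1 x2 where x: "\<And>t. t \<in> {0..1} \<Longrightarrow> (x1 + t, x2 + a * t\<^sup>2) \<in> parabola_set"
    using parabola_set_contains[OF a] by blast
  let ?g = "indicator (stage N \<delta>) :: real \<times> real \<Rightarrow> complex"
  have mem: "(x1 + t, x2 + a * t\<^sup>2 + s) \<in> stage N \<delta>" if "t \<in> {0..1}" "s \<in> {-\<delta>..\<delta>}" for t s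
    using x[OF that(1)] that(2) by (intro subsetD[OF vthick_parabola_set_subset_stage]) (force simp: vthick_def)
  have inner: "(\<integral>\<^sup>+ s \<in> {-\<delta>..\<delta>}. ennreal (cmod (?g (x1 + t, x2 + a * t\<^sup>2 + s))) \<partial>lborel) = ennreal (2 * \<delta>)"
    if "t \<in> {0..1}" for t
  proof -
    have "(\<integral>\<^sup>+ s \<in> {-\<delta>..\<delta>}. ennreal (cmod (?g (x1 + t, x2 + a * t\<^sup>2 + s))) \<partial>lborel) =
        (\<integral>\<^sup>+ s. indicator {-\<delta>..\<delta>} s \<partial>lborel)"
      using mem[OF that] by (intro nn_integral_cong) (auto simp: indicator_def)
    then show ?thesis using \<delta> by simp
  qed
  have "(\<integral>\<^sup>+ t \<in> {0..1}. (\<integral>\<^sup>+ s \<in> {-\<delta>..\<delta>}. ennreal (cmod (?g (x1 + t, x2 + a * t\<^sup>2 + s))) \<partial>lborel) \<partial>lborel)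
      = (\<integral>\<^sup>+ t. ennreal (2 * \<delta>) * indicator {0..1::real} t \<partial>lborel)"
    using inner by (intro nn_integral_cong) (auto simp: indicator_def)
  also have "\<dots> = ennreal (2 * \<delta>)" by (simp add: nn_integral_cmult_indicator)
  finally have "ennreal (1 / (2 * \<delta>)) * (\<integral>\<^sup>+ t \<in> {0..1}. (\<integral>\<^sup>+ s \<in> {-\<delta>..\<delta>}.
      ennreal (cmod (?g (fst (x1, x2) + t, snd (x1, x2) + a * t\<^sup>2 + s))) \<partial>lborel) \<partial>lborel) = 1"
    using \<delta> by (simp add: ennreal_mult[symmetric])
  then show ?thesis unfolding Pmax_def by (intro SUP_upper2[of "(x1, x2)"]) auto
qed

lemma ennreal_inverse_antimono: "x \<le> y \<Longrightarrow> inverse y \<le> inverse x" for x y :: ennreal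
  including ennreal.lifting by transfer (rule ereal_inverse_antimono)

lemma epow_mono: "0 \<le> r \<Longrightarrow> x \<le> y \<Longrightarrow> epow x r \<le> epow y r"
  unfolding epow_def
  by (auto simp: top_unique less_top intro!: ennreal_leI powr_mono2 enn2real_mono)

lemma epow_1 [simp]: "epow 1 r = 1"
  by (simp add: epow_def)

text \<open>Meant for \<open>{1..2}\<close>, which has measure 1: the pointwise bound on the maximal
  function then passes to every exponent \<open>q\<close> with the same constant.\<close>

lemma Lp_norm_ge_1:
  assumes "1 \<le> q" and f: "\<And>x. x \<in> space M \<Longrightarrow> 1 \<le> f x" and M: "emeasure M (space M) = 1"
  shows "1 \<le> Lp_norm M q f"
proof (cases "q = \<infinity>")
  case True
  have "1 \<le> C" if "AE x in M. f x \<le> C" for C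
  proof (rule ccontr)
    assume "\<not> 1 \<le> C"
    \<comment> \<open>As \<open>f\<close> is at least 1 everywhere, an essential bound
      \<open>C\<close> below 1 would make the whole space null.\<close>
    then have "AE x in M. False"
      using that by (elim AE_mp) (use f order_trans in \<open>blast intro: AE_I2\<close>)
    then have "space M \<in> null_sets M" using AE_iff_null_sets[of "space M" M] by simp
    then show False using M by auto
  qed
  then show ?thesis using True by (auto simp: Lp_norm_def intro: Inf_greatest)
next
  case False
  have "1 = (\<integral>\<^sup>+ x. 1 \<partial>M)" using M by simp
  also have "\<dots> \<le> (\<integral>\<^sup>+ x. epow (f x) (enn2real q) \<partial>M)"
    using epow_mono[OF enn2real_nonneg f] by (intro nn_integral_mono) simp
  finally show ?thesis
    using False epow_mono[of "1 / enn2real q" 1] by (simp add: Lp_norm_def)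
qed

lemma Lp_norm_indicator:
  assumes "1 \<le> p" "A \<in> sets M" "0 < emeasure M A"
  shows "Lp_norm M p (indicator A) = (if p = \<infinity> then 1 else epow (emeasure M A) (1 / enn2real p))"
proof (cases "p = \<infinity>")
  case True
  have "1 \<le> C" if C: "AE x in M. indicator A x \<le> C" for C :: ennreal
  proof (rule ccontr)
    assume C1: "\<not> 1 \<le> C"
    have "AE x in M. x \<notin> A"
      by (rule AE_mp[OF C]) (use C1 in \<open>auto simp: indicator_def\<close>)
    then have "A \<in> null_sets M" using assms(2) by (simp add: AE_iff_null_sets)
    then show False using assms(3) by auto
  qed
  then have "1 \<le> Inf {C :: ennreal. AE x in M. indicator A x \<le> C}"
    by (intro Inf_greatest) simp
  moreover have "Inf {C :: ennreal. AE x in M. indicator A x \<le> C} \<le> 1"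
    by (rule Inf_lower) (simp add: indicator_def)
  ultimately have "Inf {C :: ennreal. AE x in M. indicator A x \<le> C} = 1"
    by (rule antisym[rotated])
  then show ?thesis using True by (simp add: Lp_norm_def)
next
  case False
  have "epow (indicator A x) (enn2real p) = indicator A x" for x
    using False assms(1) by (auto simp: indicator_def epow_def)
  then show ?thesis using False assms by (simp add: Lp_norm_def)
qed

text \<open>The test function is the indicator of the stage: the numerator is at least 1, and the
  denominator is finite by compactness and nonzero by \<open>emeasure_stage_pos\<close>.\<close>

lemma Bconst_ge:
  assumes p: "1 \<le> p" and q: "1 \<le> q" and \<delta>: "0 < \<delta>"
  shows "1 / (if p = \<infinity> then 1 else epow (emeasure lborel (stage N \<delta>)) (1 / enn2real p)) \<le> Bconst p q \<delta>"
proof -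
  let ?E = "stage N \<delta>"
  let ?g = "indicator ?E :: real \<times> real \<Rightarrow> complex"
  have Es: "?E \<in> sets lborel" by (simp add: borel_compact compact_stage)
  have g: "(\<lambda>x. ennreal (cmod (?g x))) = indicator ?E" by (auto simp: indicator_def)
  note pos = emeasure_stage_pos[OF \<delta>, of N]
  have fin: "emeasure lborel ?E < \<infinity>"
    using emeasure_compact_finite[OF compact_stage, of N \<delta>] by simp
  have nrm: "Lp_norm lborel p (\<lambda>x. ennreal (cmod (?g x))) =
      (if p = \<infinity> then 1 else epow (emeasure lborel ?E) (1 / enn2real p))"
    unfolding g by (rule Lp_norm_indicator[OF p Es pos])
  have "0 < Lp_norm lborel p (\<lambda>x. ennreal (cmod (?g x)))"
    "Lp_norm lborel p (\<lambda>x. ennreal (cmod (?g x))) < \<infinity>"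
    unfolding nrm using pos fin by (auto simp: epow_def enn2real_eq_0_iff)
  moreover have "1 \<le> Lp_norm (restrict_space lborel {1..2}) q (Pmax \<delta> ?g)"
    by (rule Lp_norm_ge_1[OF q])
      (auto simp: space_restrict_space emeasure_restrict_space intro!: Pmax_indicator_ge_1[OF \<delta>])
  moreover have "?g \<in> borel_measurable lborel" using Es by simp
  ultimately show ?thesis
    unfolding Bconst_def nrm[symmetric] by (intro SUP_upper2[of ?g] divide_right_mono_ennreal) auto
qed

lemma Bconst_log_lower_bound:
  fixes p q :: ennreal
  assumes p: "1 \<le> p" and q: "1 \<le> q"
  shows "\<exists>cpq :: real. cpq > 0 \<and> (\<exists>\<delta>0 > 0. \<forall>\<delta>. 0 < \<delta> \<and> \<delta> < \<delta>0 \<longrightarrow>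
           ennreal (cpq * ln (1 / \<delta>) powr (if p = \<infinity> then 0 else 2 / enn2real p))
             \<le> Bconst p q \<delta>)"
proof -
  obtain C \<delta>\<^sub>0 N where C: "0 < C" "0 < \<delta>\<^sub>0" "\<delta>\<^sub>0 \<le> 1"
    "\<And>\<delta>. 0 < \<delta> \<Longrightarrow> \<delta> < \<delta>\<^sub>0 \<Longrightarrow>
       emeasure lborel (stage (N \<delta>) \<delta>) \<le> ennreal (C * ln (1 / \<delta>) powr (-2))"
    using stage_measure_log by metis
  define r where "r = enn2real p"
  \<comment> \<open>The constant left after inverting \<open>(C * L powr (-2)) powr (1 / r)\<close>,
    next to \<open>L powr (2 / r)\<close>. For \<open>p = \<infinity>\<close> the indicator has norm
    1 and the logarithm gets exponent 0.\<close>
  define c where "c = (if p = \<infinity> then 1 else C powr (- (1 / r)))"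
  have "ennreal (c * ln (1 / \<delta>) powr (if p = \<infinity> then 0 else 2 / enn2real p)) \<le> Bconst p q \<delta>"
    if \<delta>: "0 < \<delta>" "\<delta> < \<delta>\<^sub>0" for \<delta>
  proof -
    define L where "L = ln (1 / \<delta>)"
    have L: "0 < L" using \<delta> C(3) by (simp add: L_def ln_div)
    have "ennreal (c * L powr (if p = \<infinity> then 0 else 2 / r)) \<le>
        1 / (if p = \<infinity> then 1 else epow (emeasure lborel (stage (N \<delta>) \<delta>)) (1 / r))"
    proof (cases "p = \<infinity>")
      case True
      then show ?thesis using L by (simp add: c_def)
    next
      case False
      have CL: "0 < C * L powr (-2)" using C L by simp
      have "epow (emeasure lborel (stage (N \<delta>) \<delta>)) (1 / r) \<le> epow (ennreal (C * L powr (-2))) (1 / r)"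
        unfolding L_def using C(4)[OF \<delta>] by (intro epow_mono) (auto simp: r_def)
      also have "\<dots> = ennreal ((C * L powr (-2)) powr (1 / r))"
        using CL by (simp add: epow_def)
      finally have "1 / ennreal ((C * L powr (-2)) powr (1 / r)) \<le>
          1 / epow (emeasure lborel (stage (N \<delta>) \<delta>)) (1 / r)"
        by (simp add: divide_ennreal_def ennreal_inverse_antimono)
      moreover have "1 / ennreal ((C * L powr (-2)) powr (1 / r)) = ennreal (1 / (C * L powr (-2)) powr (1 / r))"
        using C L divide_ennreal[of 1 "(C * L powr (-2)) powr (1 / r)"] by simp
      moreover have "1 / (C * L powr (-2)) powr (1 / r) = C powr (- (1 / r)) * L powr (2 / r)"
      proof -
        have "(C * L powr (-2)) powr (1 / r) = C powr (1 / r) * L powr (- (2 / r))"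
          using C L by (simp only: powr_mult powr_powr) simp
        then show ?thesis by (simp add: powr_minus field_simps)
      qed
      ultimately show ?thesis using False by (simp add: c_def)
    qed
    also have "\<dots> \<le> Bconst p q \<delta>"
      unfolding r_def by (rule Bconst_ge[OF p q \<delta>(1)])
    finally show ?thesis unfolding L_def r_def .
  qed
  moreover have "0 < c" using C by (simp add: c_def)
  ultimately show ?thesis using C(2) by blast
qed

section \<open>A null set containing parabolas of all apertures, and its consequences\<close>

theorem theorem1p2:
  shows "\<exists>K :: (real \<times> real) set. \<exists>c :: real.
     compact K \<and> emeasure lborel K = 0 \<and> c > 0 \<and>
     (\<forall>a \<in> {1..2::real}. \<exists>x1 x2 u v :: real.
         0 \<le> u \<and> u \<le> v \<and> v \<le> 1 \<and> c \<le> v - u \<and>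
         (\<forall>t \<in> {u..v}. (x1 + t, x2 + a * t\<^sup>2) \<in> K)) \<and>
     (\<exists>C :: real. \<exists>\<delta>0 > 0. \<forall>\<delta>. 0 < \<delta> \<and> \<delta> < \<delta>0 \<longrightarrow>
         emeasure lborel (vthick K \<delta>) \<le> ennreal (C * ln (1 / \<delta>) powr (-2))) \<and>
     (\<forall>p q :: ennreal. 1 \<le> p \<longrightarrow> 1 \<le> q \<longrightarrow>
        (\<exists>cpq :: real. cpq > 0 \<and> (\<exists>\<delta>0 > 0. \<forall>\<delta>. 0 < \<delta> \<and> \<delta> < \<delta>0 \<longrightarrow>
           ennreal (cpq * ln (1 / \<delta>) powr (if p = \<infinity> then 0 else 2 / enn2real p))
             \<le> Bconst p q \<delta>)))"
proof (rule exI[of _ parabola_set], rule exI[of _ 1], intro conjI)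
  show "\<forall>a \<in> {1..2::real}. \<exists>x1 x2 u v :: real.
         0 \<le> u \<and> u \<le> v \<and> v \<le> 1 \<and> 1 \<le> v - u \<and>
         (\<forall>t \<in> {u..v}. (x1 + t, x2 + a * t\<^sup>2) \<in> parabola_set)"
  proof
    fix a :: real assume "a \<in> {1..2}"
    from parabola_set_contains[OF this] obtain x1 x2
      where "\<forall>t\<in>{0..1}. (x1 + t, x2 + a * t\<^sup>2) \<in> parabola_set" by blast
    then show "\<exists>x1 x2 u v :: real. 0 \<le> u \<and> u \<le> v \<and> v \<le> 1 \<and> 1 \<le> v - u \<and>
         (\<forall>t \<in> {u..v}. (x1 + t, x2 + a * t\<^sup>2) \<in> parabola_set)"
      \<comment> \<open>The whole of \<open>{0..1}\<close> is available for every \<open>a\<close>,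
        hence the length constant 1.\<close>
      by (intro exI[of _ x1] exI[of _ x2] exI[of _ 0] exI[of _ 1]) auto
  qed
  obtain C \<delta>\<^sub>0 N where C: "0 < \<delta>\<^sub>0"
    "\<And>\<delta>. 0 < \<delta> \<Longrightarrow> \<delta> < \<delta>\<^sub>0 \<Longrightarrow>
       emeasure lborel (stage (N \<delta>) \<delta>) \<le> ennreal (C * ln (1 / \<delta>) powr (-2))"
    using stage_measure_log by metis
  have "emeasure lborel (vthick parabola_set \<delta>) \<le> emeasure lborel (stage (N \<delta>) \<delta>)" for \<delta>
    by (intro emeasure_mono vthick_parabola_set_subset_stage) (simp add: borel_compact compact_stage)
  then show "\<exists>C :: real. \<exists>\<delta>0 > 0. \<forall>\<delta>. 0 < \<delta> \<and> \<delta> < \<delta>0 \<longrightarrow>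
         emeasure lborel (vthick parabola_set \<delta>) \<le> ennreal (C * ln (1 / \<delta>) powr (-2))"
    using C order_trans by blast
  show "\<forall>p q :: ennreal. 1 \<le> p \<longrightarrow> 1 \<le> q \<longrightarrow>
        (\<exists>cpq :: real. cpq > 0 \<and> (\<exists>\<delta>0 > 0. \<forall>\<delta>. 0 < \<delta> \<and> \<delta> < \<delta>0 \<longrightarrow>
           ennreal (cpq * ln (1 / \<delta>) powr (if p = \<infinity> then 0 else 2 / enn2real p))
             \<le> Bconst p q \<delta>))"
    by (intro allI impI Bconst_log_lower_bound)
qed (simp_all add: compact_parabola_set emeasure_parabola_set)

end
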